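(* Let $\widehat{\Gamma}_{\rm pos}^{\star}=\Gamma_{\rm pr}-\sum_{i=1}^r \frac{\delta_i^2}{1+\delta_i^2}\,\widehat{\mathbf w}_i\widehat{\mathbf w}_i^\top$. Suppose that we approximate $\log\left(|\Gamma_{\rm pr}|/|\Gamma_{\rm pos}|\right)$ by $\log\left(|\Gamma_{\rm pr}|/|\widehat{\Gamma}|\right)$ for some $\widehat{\Gamma}\in\mathcal{M}_r'$. Then $\widehat{\Gamma}_{\rm pos}^{\star}\in\mathcal{M}_r'$ minimizes the resulting approximation error, i.e. it solves $$\min_{\widehat{\Gamma}\in\mathcal{M}_r'}\ \left|\log\frac{|\Gamma_{\rm pos}|}{|\widehat{\Gamma}|}\right| .$$ Moreover, the optimal approximation and the associated error are, respectively, $$\log\frac{|\Gamma_{\rm pr}|}{|\widehat{\Gamma}_{\rm pos}^{\star}|}=\sum_{i=1}^r\log(1+\delta_i^2)\qquad\text{and}\qquad \log\frac{|\widehat{\Gamma}_{\rm pos}^{\star}|}{|\Gamma_{\rm pos}|}=\sum_{i=r+1}^n\log(1+\delta_i^2).$$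
   Context: Setting: $G\in\mathbb{R}^{m\times n}$ is the forward operator, and $\Gamma_{\rm pr}\in\mathbb{R}^{n\times n}$ (prior covariance) and $\Gamma_{\rm obs}\in\mathbb{R}^{m\times m}$ (noise covariance) are symmetric positive definite matrices. Let $H=G^\top\Gamma_{\rm obs}^{-1}G$ and let $\Gamma_{\rm pos}=(H+\Gamma_{\rm pr}^{-1})^{-1}$ be the posterior covariance of the linear-Gaussian model $\mathbf y\mid\mathbf x\sim\mathcal N(G\mathbf x,\Gamma_{\rm obs})$, $\mathbf x\sim\mathcal N(\mathbf 0,\Gamma_{\rm pr})$. Let $S_{\rm pr}\in\mathbb{R}^{n\times n}$ be any square root of $\Gamma_{\rm pr}$ in the sense that $\Gamma_{\rm pr}=S_{\rm pr}S_{\rm pr}^\top$, and let $\widehat H=S_{\rm pr}^\top H S_{\rm pr}$ be the prior-preconditioned Hessian. Let $(\delta_i^2,\mathbf w_i)$, $i=1,\dots,n$, be the eigenvalue-eigenvector pairs of $\widehat H$, with $\delta_i^2\ge\delta_{i+1}^2$ and $(\mathbf w_i)_{i=1}^n$ orthonormal, and set $\widehat{\mathbf w}_i=S_{\rm pr}\mathbf w_i$. Fix an integer $1\le r\le n$ (the maximum rank). The approximation class is $$\mathcal{M}_r'=\left\{\widehat{\Gamma}=\Gamma_{\rm pr}-BB^\top\ :\ \widehat{\Gamma}-\Gamma_{\rm pos}\succeq0,\ \mathrm{rank}(B)\le r\right\},$$ where $B$ ranges over real matrices with $n$ rows. $|A|$ denotes the determinant of a matrix $A$, $|\cdot|$ applied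 to a scalar denotes the absolute value, and $\succeq 0$ means positive semidefinite. *)

theory Defs
  imports
    Complex_Main
    "Jordan_Normal_Form.Char_Poly"
    "Jordan_Normal_Form.DL_Rank"
    "Jordan_Normal_Form.Gauss_Jordan_Elimination"
begin

definition pos_def_mat :: "nat \<Rightarrow> real mat \<Rightarrow> bool" where
  "pos_def_mat n A \<longleftrightarrow> A \<in> carrier_mat n n \<and> transpose_mat A = A \<and>
     (\<forall>x \<in> carrier_vec n. x \<noteq> 0\<^sub>v n \<longrightarrow> 0 < x \<bullet> (A *\<^sub>v x))"

definition pos_semidef_mat :: "nat \<Rightarrow> real mat \<Rightarrow> bool" where
  "pos_semidef_mat n A \<longleftrightarrow> A \<in> carrier_mat n n \<and> transpose_mat A = A \<and>
     (\<forall>x \<in> carrier_vec n. 0 \<le> x \<bullet> (A *\<^sub>v x))"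

text \<open>\<^const>\<open>mat_inverse\<close> is option-valued; the value is \<^const>\<open>Some\<close> exactly for
  invertible matrices, so this is the inverse wherever one exists and unspecified elsewhere.\<close>

abbreviation mat_inv :: "real mat \<Rightarrow> real mat" where
  "mat_inv A \<equiv> the (mat_inverse A)"

definition outer_prod :: "real vec \<Rightarrow> real vec \<Rightarrow> real mat" where
  "outer_prod u v = mat (dim_vec u) (dim_vec v) (\<lambda>(i, j). u $ i * v $ j)"

definition hessian :: "real mat \<Rightarrow> real mat \<Rightarrow> real mat" where
  "hessian G \<Gamma>obs = transpose_mat G * mat_inv \<Gamma>obs * G"

definition posterior_cov :: "real mat \<Rightarrow> real mat \<Rightarrow> real mat \<Rightarrow> real mat" where
  "posterior_cov G \<Gamma>obs \<Gamma>pr = mat_inv (hessian G \<Gamma>obs + mat_inv \<Gamma>pr)"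

definition precond_hessian :: "real mat \<Rightarrow> real mat \<Rightarrow> real mat \<Rightarrow> real mat" where
  "precond_hessian G \<Gamma>obs S = transpose_mat S * hessian G \<Gamma>obs * S"

text \<open>The number \<open>k\<close> of columns of \<open>B\<close> is unrestricted; only the rank of \<open>B\<close> is bounded.\<close>

definition approx_class :: "nat \<Rightarrow> nat \<Rightarrow> real mat \<Rightarrow> real mat \<Rightarrow> real mat set" where
  "approx_class n r \<Gamma>pr \<Gamma>pos =
     {\<Gamma>. \<exists>k. \<exists>B \<in> carrier_mat n k.
          \<Gamma> = \<Gamma>pr - B * transpose_mat B \<and>
          pos_semidef_mat n (\<Gamma> - \<Gamma>pos) \<and> vec_space.rank n B \<le> r}"

definition opt_cov ::
  "nat \<Rightarrow> nat \<Rightarrow> real mat \<Rightarrow> real mat \<Rightarrow> (nat \<Rightarrow> real) \<Rightarrow> (nat \<Rightarrow> real vec) \<Rightarrow> real mat" where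
  "opt_cov n r \<Gamma>pr S \<delta> w =
     \<Gamma>pr - (\<Oplus>\<^bsub>module_mat TYPE(real) n n\<^esub> i \<in> {1..r}.
              ((\<delta> i)\<^sup>2 / (1 + (\<delta> i)\<^sup>2)) \<cdot>\<^sub>m outer_prod (S *\<^sub>v w i) (S *\<^sub>v w i))"

end

theory Submission
  imports Defs
begin

text \<open>With \<open>W\<close> the orthogonal matrix of eigenvectors and \<open>T = S W\<close>, one has \<open>\<Gamma>pr = T T\<^sup>T\<close>,
  \<open>\<Gamma>pos = T E T\<^sup>T\<close> and \<open>\<Gamma>star = T E' T\<^sup>T\<close>, where \<open>E\<close> is diagonal with the increasing entries
  \<open>e\<^sub>i = 1 / (1 + \<delta>\<^sub>i\<^sup>2)\<close> and \<open>E'\<close> keeps the first \<open>r\<close> of them and is \<open>1\<close> elsewhere. A member of the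
  class becomes \<open>T M T\<^sup>T\<close> with \<open>M = I - C C\<^sup>T\<close>, \<open>M \<succeq> E\<close> and \<open>rank C \<le> r\<close>, and everything follows from
  \<open>det M \<ge> \<Prod>\<^sub>i\<^sub>\<le>\<^sub>r e\<^sub>i\<close>.

  For the latter, no spectral theorem is used. Factor \<open>C = Y Z\<close> with \<open>Y\<close> injective with \<open>k \<le> r\<close> columns.
  Sylvester's identity gives \<open>det M \<cdot> det (Y\<^sup>T Y) = det (Y\<^sup>T M Y)\<close>, and monotonicity of the determinant
  bounds this below by \<open>det (Y\<^sup>T D Y)\<close>, where \<open>D\<close> is diagonal with entries \<open>min e\<^sub>i e\<^sub>k\<close>. After dividing
  by \<open>e\<^sub>k\<close> only the first \<open>k\<close> rows of \<open>Y\<close> carry a weight \<open>c \<le> 1\<close> different from \<open>1\<close>; each such weight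
  changes the Gram determinant affinely in \<open>c\<close>, with a nonnegative value at \<open>c = 0\<close>, hence by a factor
  of at least \<open>c\<close>.\<close>

section \<open>Determinants and definite quadratic forms\<close>

text \<open>Sylvester's identity. The block matrix \<open>?M\<close> is multiplied by the
  unit-determinant triangular matrix \<open>?L\<close> on either side; each product is block
  triangular and exposes one of the two determinants.\<close>

lemma det_one_minus_mult_commute:
  fixes A B :: "real mat"
  assumes A: "A \<in> carrier_mat n k" and B: "B \<in> carrier_mat k n"
  shows "det (1\<^sub>m n - A * B) = det (1\<^sub>m k - B * A)"
proof -
  let ?M = "four_block_mat (1\<^sub>m n) A B (1\<^sub>m k)"
  let ?L = "four_block_mat (1\<^sub>m n) (0\<^sub>m n k) (- B) (1\<^sub>m k)"
  have M: "?M \<in> carrier_mat (n + k) (n + k)" and L: "?L \<in> carrier_mat (n + k) (n + k)"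
    using A B by auto
  have BA: "B * A \<in> carrier_mat k k" and AB: "A * B \<in> carrier_mat n n"
    using mult_carrier_mat[OF B A] mult_carrier_mat[OF A B] by blast+
  have dL: "det ?L = 1"
    using B by (subst det_four_block_mat_upper_right_zero[of _ n]) auto
  have e1: "- B * 1\<^sub>m n + 1\<^sub>m k * B = 0\<^sub>m k n"
    using A B by (intro eq_matI) auto
  have e2: "- B * A + 1\<^sub>m k * 1\<^sub>m k = 1\<^sub>m k - B * A"
    using A B BA by (intro eq_matI) auto
  have "?L * ?M = four_block_mat (1\<^sub>m n) A (0\<^sub>m k n) (1\<^sub>m k - B * A)"
    using A B e1 e2 by (subst mult_four_block_mat[of _ n n _ k _ k _ _ n _ k]) auto
  hence 1: "det (?L * ?M) = det (1\<^sub>m k - B * A)"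
    using A minus_carrier_mat[OF BA] by (simp add: det_four_block_mat_lower_left_zero[of _ n _ k])
  have "?M * ?L = four_block_mat (1\<^sub>m n - A * B) A (0\<^sub>m k n) (1\<^sub>m k)"
    by (subst mult_four_block_mat[of _ n n _ k _ k _ _ n _ k])
       (use A B AB in \<open>auto intro!: cong_four_block_mat eq_matI\<close>)
  hence 2: "det (?M * ?L) = det (1\<^sub>m n - A * B)"
    using A minus_carrier_mat[OF AB] by (simp add: det_four_block_mat_lower_left_zero[of _ n _ k])
  show ?thesis
    using 1 2 det_mult[OF M L] det_mult[OF L M] dL by simp
qed

section \<open>Outer products and quadratic forms\<close>

lemma outer_prod_carrier [simp]:
  "u \<in> carrier_vec n \<Longrightarrow> v \<in> carrier_vec k \<Longrightarrow> outer_prod u v \<in> carrier_mat n k"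
  by (auto simp: outer_prod_def)

lemma outer_prod_mult_vec:
  assumes "u \<in> carrier_vec n" "v \<in> carrier_vec k" "x \<in> carrier_vec k"
  shows "outer_prod u v *\<^sub>v x = (v \<bullet> x) \<cdot>\<^sub>v u"
  using assms
  by (intro eq_vecI) (auto simp: outer_prod_def scalar_prod_def sum_distrib_right sum_distrib_left ac_simps)

lemma transpose_outer_prod [simp]: "transpose_mat (outer_prod u u) = outer_prod u u"
  by (intro eq_matI) (auto simp: outer_prod_def)

lemma quad_add:
  assumes "A \<in> carrier_mat n n" "B \<in> carrier_mat n n" "x \<in> carrier_vec n" "y \<in> carrier_vec n"
  shows "y \<bullet> ((A + B) *\<^sub>v x) = y \<bullet> (A *\<^sub>v x) + y \<bullet> (B *\<^sub>v x :: real vec)"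
  using assms by (subst add_mult_distrib_mat_vec) (auto simp: scalar_prod_add_distrib[of _ n])

lemma quad_minus:
  assumes "A \<in> carrier_mat n n" "B \<in> carrier_mat n n" "x \<in> carrier_vec n" "y \<in> carrier_vec n"
  shows "y \<bullet> ((A - B) *\<^sub>v x) = y \<bullet> (A *\<^sub>v x) - y \<bullet> (B *\<^sub>v x :: real vec)"
  using assms by (subst minus_mult_distrib_mat_vec) (auto simp: scalar_prod_minus_distrib[of _ n])

lemma transpose_smult_mat: "transpose_mat (c \<cdot>\<^sub>m A) = c \<cdot>\<^sub>m transpose_mat A"
  by (intro eq_matI) auto

lemma quad_smult:
  assumes "A \<in> carrier_mat n n" "x \<in> carrier_vec n" "y \<in> carrier_vec n"
  shows "y \<bullet> ((c \<cdot>\<^sub>m A) *\<^sub>v x) = c * (y \<bullet> (A *\<^sub>v x :: real vec))"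
proof -
  have "(c \<cdot>\<^sub>m A) *\<^sub>v x = c \<cdot>\<^sub>v (A *\<^sub>v x)"
    using assms by (intro eq_vecI) (auto simp: scalar_prod_def sum_distrib_left ac_simps)
  thus ?thesis using assms by simp
qed

lemma quad_outer_prod:
  assumes "u \<in> carrier_vec n" "x \<in> carrier_vec n"
  shows "x \<bullet> (outer_prod u u *\<^sub>v x) = (u \<bullet> x)\<^sup>2"
  using assms by (simp add: outer_prod_mult_vec power2_eq_square comm_scalar_prod[of x n])

lemma quad_congruence:
  fixes A :: "real mat"
  assumes "A \<in> carrier_mat n n" "Y \<in> carrier_mat n k" "x \<in> carrier_vec k"
  shows "x \<bullet> ((transpose_mat Y * A * Y) *\<^sub>v x) = (Y *\<^sub>v x) \<bullet> (A *\<^sub>v (Y *\<^sub>v x))"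
proof -
  have "(transpose_mat Y * A * Y) *\<^sub>v x = transpose_mat Y *\<^sub>v (A *\<^sub>v (Y *\<^sub>v x))"
    using assms by (simp add: assoc_mult_mat_vec[of _ k n _ k] assoc_mult_mat_vec[of _ k n _ n])
  thus ?thesis
    using assms transpose_vec_mult_scalar[of Y n k x "A *\<^sub>v (Y *\<^sub>v x)"]
    by (simp add: comm_scalar_prod[of x k] comm_scalar_prod[of "A *\<^sub>v (Y *\<^sub>v x)" n])
qed

lemma quad_sym:
  fixes A :: "real mat"
  assumes "A \<in> carrier_mat n n" "transpose_mat A = A" "x \<in> carrier_vec n" "y \<in> carrier_vec n"
  shows "x \<bullet> (A *\<^sub>v y) = y \<bullet> (A *\<^sub>v x)"
  using transpose_vec_mult_scalar[of A n n y x] assms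
  by (simp add: comm_scalar_prod[of y n])

section \<open>Definite matrices and their determinants\<close>

lemma pos_def_imp_semidef: "pos_def_mat n A \<Longrightarrow> pos_semidef_mat n A"
  unfolding pos_def_mat_def pos_semidef_mat_def
  by (metis order_less_imp_le order_refl mult_mat_vec_carrier scalar_prod_left_zero)

lemma pos_def_add_semidef:
  assumes "pos_def_mat n A" "pos_semidef_mat n P"
  shows "pos_def_mat n (A + P)"
  using assms unfolding pos_def_mat_def pos_semidef_mat_def
  by (auto simp: quad_add[of _ n] transpose_add[of _ n n] intro!: add_pos_nonneg)

lemma pos_semidef_add:
  assumes "pos_semidef_mat n A" "pos_semidef_mat n P"
  shows "pos_semidef_mat n (A + P)"
  using assms unfolding pos_semidef_mat_def
  by (auto simp: quad_add[of _ n] transpose_add[of _ n n])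

lemma pos_semidef_smult_outer_prod:
  assumes "y \<in> carrier_vec n" "0 \<le> t"
  shows "pos_semidef_mat n (t \<cdot>\<^sub>m outer_prod y y)"
  using assms unfolding pos_semidef_mat_def
  by (auto simp: quad_smult[of _ n] quad_outer_prod transpose_smult_mat)

lemma pos_def_det_nonzero:
  assumes "pos_def_mat n A"
  shows "det A \<noteq> 0"
  using assms det_0_iff_vec_prod_zero_field[of A n] unfolding pos_def_mat_def
  by (metis order_less_irrefl scalar_prod_right_zero)

text \<open>The segment from the identity to \<open>A\<close> consists of positive definite
  matrices, so the determinant has no zero on it and keeps the sign it has at the identity.\<close>

lemma pos_def_det_pos:
  assumes A: "pos_def_mat n A"
  shows "0 < det A"
proof (rule ccontr)
  assume "\<not> 0 < det A"
  define F where "F t = t \<cdot>\<^sub>m A + (1 - t) \<cdot>\<^sub>m 1\<^sub>m n" for t :: real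
  have Ac: "A \<in> carrier_mat n n" using A by (simp add: pos_def_mat_def)
  have F: "F t \<in> carrier_mat n n" for t using Ac by (simp add: F_def)
  have "continuous_on {0..1} (\<lambda>t. det (F t))"
  proof -
    \<comment> \<open>The Leibniz expansion is polynomial in \<open>t\<close>, hence
      continuous.\<close>
    have "det (F t) = (\<Sum> p \<in> {p. p permutes {0 ..< n}}. signof p *
       (\<Prod> i = 0 ..< n. t * A $$ (i, p i) + (1 - t) * 1\<^sub>m n $$ (i, p i)))" for t
      unfolding det_def'[OF F]
      using Ac permutes_in_image
      by (intro sum.cong refl arg_cong[where f = "(*) _"] prod.cong) (fastforce simp: F_def)+
    thus ?thesis by (simp only:) (intro continuous_intros)
  qed
  moreover have "F 0 = 1\<^sub>m n" "F 1 = A" using Ac by (auto simp: F_def intro!: eq_matI)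
  ultimately obtain t where t: "0 \<le> t" "t \<le> 1" "det (F t) = 0"
    using IVT2'[of "\<lambda>t. det (F t)" 1 0 0] \<open>\<not> 0 < det A\<close> by auto
  have "pos_def_mat n (F t)"
    unfolding pos_def_mat_def
  proof (intro conjI ballI impI)
    show "transpose_mat (F t) = F t"
      using A by (auto simp: F_def pos_def_mat_def transpose_add[of _ n n] transpose_smult_mat)
    fix x :: "real vec" assume x: "x \<in> carrier_vec n" "x \<noteq> 0\<^sub>v n"
    obtain i where "i < n" "x $ i \<noteq> 0" using x by (metis carrier_vecD eq_vecI index_zero_vec)
    hence "0 < x \<bullet> x"
      using x by (auto simp: scalar_prod_def zero_less_mult_iff intro!: sum_pos2[of _ i])
    moreover have "0 < x \<bullet> (A *\<^sub>v x)" using A x by (simp add: pos_def_mat_def)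
    moreover have "x \<bullet> (F t *\<^sub>v x) = t * (x \<bullet> (A *\<^sub>v x)) + (1 - t) * (x \<bullet> x)"
      using x Ac by (simp add: F_def quad_add[of _ n] quad_smult[of _ n])
    \<comment> \<open>For \<open>t < 1\<close> the identity part is strictly positive; at
      \<open>t = 1\<close> it vanishes and \<open>A\<close> supplies the strictness.\<close>
    ultimately show "0 < x \<bullet> (F t *\<^sub>v x)"
      using t(1,2) by (cases "t = 1") (auto intro: add_nonneg_pos)
  qed (rule F)
  thus False using t(3) pos_def_det_nonzero by blast
qed

text \<open>Solving \<open>A u = y\<close> factors the perturbed matrix as
  \<open>A (1 + t u y^T)\<close>, and Sylvester's identity turns the second determinant into the
  scalar \<open>1 + t (y \<bullet> u)\<close>. Later arguments use only that the result is affine in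
  \<open>t\<close>, so the slope stays anonymous.\<close>

lemma det_rank_one_update:
  fixes A :: "real mat"
  assumes A: "A \<in> carrier_mat n n" "det A \<noteq> 0" and y: "y \<in> carrier_vec n"
  shows "\<exists>\<beta>. \<forall>t. det (A + t \<cdot>\<^sub>m outer_prod y y) = det A + t * \<beta>"
proof -
  obtain B where B: "B \<in> carrier_mat n n" "A * B = 1\<^sub>m n"
    using det_non_zero_imp_unit[OF A, of undefined] by (auto simp: Units_def ring_mat_def)
  define u where "u = B *\<^sub>v y"
  have u: "u \<in> carrier_vec n" using B y by (simp add: u_def)
  have Au: "A *\<^sub>v u = y" unfolding u_def using A B y by (simp flip: assoc_mult_mat_vec)
  \<comment> \<open>The sign in \<open>U t\<close> fits the form \<open>1 - U V\<close> of
    Sylvester's identity.\<close>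
  define U where "U t = mat n 1 (\<lambda>(i, j). - t * u $ i)" for t
  define V where "V = mat 1 n (\<lambda>(i, j). y $ j)"
  have V: "V \<in> carrier_mat 1 n" and U: "U t \<in> carrier_mat n 1" for t
    by (auto simp: U_def V_def)
  have "det (A + t \<cdot>\<^sub>m outer_prod y y) = det A + t * (det A * (y \<bullet> u))" for t
  proof -
    have "A + t \<cdot>\<^sub>m outer_prod y y = A * (1\<^sub>m n - U t * V)"
    proof -
      have "A * (U t * V) = - (t \<cdot>\<^sub>m outer_prod y y)"
      proof (rule eq_matI)
        fix i j assume "i < dim_row (- (t \<cdot>\<^sub>m outer_prod y y))" "j < dim_col (- (t \<cdot>\<^sub>m outer_prod y y))"
        hence ij: "i < n" "j < n" using y by (auto simp: outer_prod_def)
        have "(A * (U t * V)) $$ (i, j) = - t * y $ j * (A *\<^sub>v u) $ i"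
          using A ij u by (auto simp: scalar_prod_def U_def V_def sum_distrib_left sum_negf ac_simps)
        thus "(A * (U t * V)) $$ (i, j) = (- (t \<cdot>\<^sub>m outer_prod y y)) $$ (i, j)"
          using ij y unfolding Au by (auto simp: outer_prod_def)
      qed (use A y V in \<open>auto simp: outer_prod_def\<close>)
      thus ?thesis using A U V y
        by (auto simp: mult_minus_distrib_mat[OF A(1) one_carrier_mat mult_carrier_mat[OF U V]]
          intro!: eq_matI)
    qed
    also have "det \<dots> = det A * det (1\<^sub>m n - U t * V)"
      using A minus_carrier_mat[OF mult_carrier_mat[OF U V]] by (intro det_mult[of _ n]) auto
    also have "det (1\<^sub>m n - U t * V) = det (1\<^sub>m 1 - V * U t)"
      using U V by (intro det_one_minus_mult_commute)
    also have "1\<^sub>m 1 - V * U t = mat 1 1 (\<lambda>_. 1 + t * (y \<bullet> u))"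
      using u y by (intro eq_matI) (auto simp: U_def V_def scalar_prod_def sum_negf sum_distrib_left ac_simps)
    also have "det \<dots> = 1 + t * (y \<bullet> u)" by (subst det_single) auto
    finally show ?thesis by (simp add: algebra_simps)
  qed
  thus ?thesis by blast
qed

text \<open>A negative slope in the affine formula would force the determinant to vanish at some
  \<open>t > 0\<close>, where the matrix is still positive definite.\<close>

lemma det_add_rank_one_ge:
  assumes A: "pos_def_mat n A" and y: "y \<in> carrier_vec n"
  shows "det A \<le> det (A + outer_prod y y)"
proof (rule ccontr)
  assume less: "\<not> ?thesis"
  have Ac: "A \<in> carrier_mat n n" using A by (simp add: pos_def_mat_def)
  obtain \<beta> where \<beta>: "det (A + t \<cdot>\<^sub>m outer_prod y y) = det A + t * \<beta>" for t
    using det_rank_one_update[OF Ac pos_def_det_nonzero[OF A] y] by blast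
  have one: "1 \<cdot>\<^sub>m outer_prod y y = outer_prod y y" by (intro eq_matI) auto
  have neg: "\<beta> < 0" using \<beta>[of 1] less by (simp add: one)
  have "0 < det (A + (- det A / \<beta>) \<cdot>\<^sub>m outer_prod y y)"
    using pos_def_det_pos[OF A] neg y
    by (intro pos_def_det_pos[OF pos_def_add_semidef[OF A]] pos_semidef_smult_outer_prod)
       (auto simp: divide_nonneg_neg)
  thus False using \<beta>[of "- det A / \<beta>"] neg by simp
qed

text \<open>The determinant is affine in the weight and positive for all weights in
  \<open>{0<..1}\<close>, so its value at 0 is nonnegative. Such a function lies above the line
  through the origin that has the same value at 1.\<close>

lemma det_scale_rank_one_ge:
  assumes A: "pos_semidef_mat n A" and y: "y \<in> carrier_vec n"
    and pd: "pos_def_mat n (A + outer_prod y y)" and c: "0 < c" "c \<le> 1"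
  shows "pos_def_mat n (A + c \<cdot>\<^sub>m outer_prod y y)"
    and "c * det (A + outer_prod y y) \<le> det (A + c \<cdot>\<^sub>m outer_prod y y)"
proof -
  let ?O = "outer_prod y y"
  have Ac: "A \<in> carrier_mat n n" using A by (simp add: pos_semidef_mat_def)
  have pd': "pos_def_mat n (A + s \<cdot>\<^sub>m ?O)" if s: "0 < s" "s \<le> 1" for s
    unfolding pos_def_mat_def
  proof (intro conjI ballI impI)
    show "transpose_mat (A + s \<cdot>\<^sub>m ?O) = A + s \<cdot>\<^sub>m ?O"
      using A y by (auto simp: pos_semidef_mat_def transpose_add[of _ n n] transpose_smult_mat)
    fix x :: "real vec" assume x: "x \<in> carrier_vec n" "x \<noteq> 0\<^sub>v n"
    have "0 < x \<bullet> ((A + ?O) *\<^sub>v x)" using pd x by (simp add: pos_def_mat_def)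
    hence "0 < s * (x \<bullet> (A *\<^sub>v x) + (y \<bullet> x)\<^sup>2)"
      using Ac x y s by (simp add: quad_add quad_outer_prod)
    \<comment> \<open>Scaling only the outer product keeps the nonnegative form of \<open>A\<close>
      whole instead of shrinking it by \<open>s\<close>.\<close>
    also have "\<dots> \<le> x \<bullet> (A *\<^sub>v x) + s * (y \<bullet> x)\<^sup>2"
      using A x s by (auto simp: pos_semidef_mat_def distrib_left intro: mult_left_le_one_le)
    finally show "0 < x \<bullet> ((A + s \<cdot>\<^sub>m ?O) *\<^sub>v x)"
      using Ac x y by (simp add: quad_add quad_smult[of _ n] quad_outer_prod)
  qed (use Ac y in auto)
  show "pos_def_mat n (A + c \<cdot>\<^sub>m outer_prod y y)" using pd' c .
  have AO: "A + ?O \<in> carrier_mat n n" using Ac y by simp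
  \<comment> \<open>\<open>A\<close> itself may be singular, so the expansion is based at
    \<open>A + ?O\<close>; weight \<open>s\<close> then corresponds to the parameter
    \<open>s - 1\<close>.\<close>
  obtain \<beta> where \<beta>: "det (A + ?O + t \<cdot>\<^sub>m ?O) = det (A + ?O) + t * \<beta>" for t
    using det_rank_one_update[OF AO pos_def_det_nonzero[OF pd] y] by blast
  have "A + s \<cdot>\<^sub>m ?O = A + ?O + (s - 1) \<cdot>\<^sub>m ?O" for s
    using Ac y by (intro eq_matI) (auto simp: outer_prod_def algebra_simps)
  hence det: "det (A + s \<cdot>\<^sub>m ?O) = det (A + ?O) + (s - 1) * \<beta>" for s
    using \<beta> by simp
  have "\<beta> \<le> det (A + ?O)"
  proof (rule ccontr)
    assume gt: "\<not> ?thesis"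
    \<comment> \<open>The zero of the affine determinant; a slope above the value at weight 1 would
      place it in \<open>{0<..1}\<close>.\<close>
    define s where "s = 1 - det (A + ?O) / \<beta>"
    have "0 < s" "s \<le> 1" "(s - 1) * \<beta> = - det (A + ?O)"
      using gt pos_def_det_pos[OF pd] by (auto simp: s_def field_simps)
    thus False using pos_def_det_pos[OF pd', of s] det[of s] by simp
  qed
  hence "(1 - c) * \<beta> \<le> (1 - c) * det (A + ?O)" using c by (intro mult_left_mono) auto
  thus "c * det (A + ?O) \<le> det (A + c \<cdot>\<^sub>m ?O)" using det[of c] by (simp add: algebra_simps)
qed

section \<open>Congruences, diagonal matrices and monotonicity\<close>

lemma transpose_congruence:
  fixes A :: "real mat"
  assumes "A \<in> carrier_mat n n" "Y \<in> carrier_mat n k"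
  shows "transpose_mat (transpose_mat Y * A * Y) = transpose_mat Y * transpose_mat A * Y"
  using assms by (simp add: transpose_mult[of _ k n _ k] transpose_mult[of _ k n _ n] transpose_mult[of _ n n _ k])

lemma pos_semidef_congruence:
  assumes "pos_semidef_mat n A" "Y \<in> carrier_mat n k"
  shows "pos_semidef_mat k (transpose_mat Y * A * Y)"
  using assms unfolding pos_semidef_mat_def
  by (auto simp: quad_congruence[of _ n _ k] transpose_congruence[of _ n _ k])

lemma pos_def_congruence:
  assumes "pos_def_mat n A" "Y \<in> carrier_mat n k"
    and "\<And>v. v \<in> carrier_vec k \<Longrightarrow> Y *\<^sub>v v = 0\<^sub>v n \<Longrightarrow> v = 0\<^sub>v k"
  shows "pos_def_mat k (transpose_mat Y * A * Y)"
  unfolding pos_def_mat_def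
proof (intro conjI ballI impI)
  fix x :: "real vec" assume x: "x \<in> carrier_vec k" "x \<noteq> 0\<^sub>v k"
  have "Y *\<^sub>v x \<in> carrier_vec n" "Y *\<^sub>v x \<noteq> 0\<^sub>v n" using x assms(2,3) by auto
  thus "0 < x \<bullet> ((transpose_mat Y * A * Y) *\<^sub>v x)"
    using assms(1,2) x by (simp add: quad_congruence[of _ n _ k] pos_def_mat_def)
qed (use assms pos_semidef_congruence[OF pos_def_imp_semidef] in \<open>auto simp: pos_semidef_mat_def\<close>)

lemma transpose_mat_diag [simp]: "transpose_mat (mat_diag n f) = mat_diag n f"
  by (intro eq_matI) (auto simp: mat_diag_def)

lemma quad_mat_diag:
  fixes f :: "nat \<Rightarrow> real"
  assumes "x \<in> carrier_vec n"
  shows "x \<bullet> (mat_diag n f *\<^sub>v x) = (\<Sum>i<n. f i * (x $ i)\<^sup>2)"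
proof -
  have "mat_diag n f *\<^sub>v x = vec n (\<lambda>i. f i * x $ i)"
    using assms
    by (intro eq_vecI) (auto simp: mat_diag_def scalar_prod_def if_distrib sum.If_cases if_distribR cong: if_cong)
  thus ?thesis
    using assms by (auto simp: scalar_prod_def power2_eq_square ac_simps atLeast0LessThan)
qed

lemma pos_semidef_mat_diag: "(\<And>i. i < n \<Longrightarrow> 0 \<le> f i) \<Longrightarrow> pos_semidef_mat n (mat_diag n f)"
  unfolding pos_semidef_mat_def by (auto simp: quad_mat_diag intro!: sum_nonneg)

lemma pos_def_mat_diag:
  assumes "\<And>i. i < n \<Longrightarrow> 0 < f i"
  shows "pos_def_mat n (mat_diag n f)"
  unfolding pos_def_mat_def
proof (intro conjI ballI impI)
  fix x :: "real vec" assume x: "x \<in> carrier_vec n" "x \<noteq> 0\<^sub>v n"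
  then obtain i where i: "i < n" "x $ i \<noteq> 0" by (metis carrier_vecD eq_vecI index_zero_vec)
  show "0 < x \<bullet> (mat_diag n f *\<^sub>v x)"
    unfolding quad_mat_diag[OF x(1)]
    using assms i by (intro sum_pos2[of _ i]) (auto intro!: mult_nonneg_nonneg dest: less_imp_le)
qed auto

text \<open>A positive semidefinite form is peeled off one coordinate at a time: subtracting
  \<open>y y\<^sup>T\<close> with \<open>y = P e\<^sub>i / sqrt (P\<^sub>i\<^sub>i)\<close> kills the \<open>i\<close>th column and keeps the zero columns zero;
  semidefiniteness persists by the Cauchy--Schwarz inequality for \<open>P\<close>.\<close>

lemma pos_semidef_induct [consumes 1, case_names zero add]:
  assumes "pos_semidef_mat n P"
    and zero: "Q (0\<^sub>m n n)"
    and add: "\<And>A y. pos_semidef_mat n A \<Longrightarrow> y \<in> carrier_vec n \<Longrightarrow> Q A \<Longrightarrow> Q (A + outer_prod y y)"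
  shows "Q P"
  using assms(1)
proof (induction "card {i. i < n \<and> col P i \<noteq> 0\<^sub>v n}" arbitrary: P rule: less_induct)
  case less
  note P = less.prems
  have Pc: "P \<in> carrier_mat n n" and Pt: "transpose_mat P = P"
    using P by (auto simp: pos_semidef_mat_def)
  have sym: "P $$ (i, j) = P $$ (j, i)" if "i < n" "j < n" for i j
    using arg_cong[OF Pt, of "\<lambda>A. A $$ (i, j)"] Pc that by simp
  show ?case
  proof (cases "\<forall>i<n. col P i = 0\<^sub>v n")
    case True
    have "P = 0\<^sub>m n n"
    proof (intro eq_matI)
      fix i j assume "i < dim_row (0\<^sub>m n n :: real mat)" "j < dim_col (0\<^sub>m n n :: real mat)"
      thus "P $$ (i, j) = 0\<^sub>m n n $$ (i, j)"
        using True Pc by (metis carrier_matD index_col index_zero_mat index_zero_vec(1))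
    qed (use Pc in auto)
    thus ?thesis using zero by simp
  next
    case False
    then obtain i where i: "i < n" "col P i \<noteq> 0\<^sub>v n" by blast
    define p where "p = P $$ (i, i)"
    define c where "c = col P i"
    have c: "c \<in> carrier_vec n" using Pc by (auto simp: c_def)
    \<comment> \<open>Semidefiniteness at \<open>x + s e_i\<close>, expanded in \<open>s\<close>.
      Suitable \<open>x\<close> and \<open>s\<close> give the sign of the pivot \<open>p\<close> as
      well as the inequality behind the semidefiniteness of \<open>R\<close>.\<close>
    have shift: "0 \<le> x \<bullet> (P *\<^sub>v x) + 2 * s * (c \<bullet> x) + s\<^sup>2 * p" if x: "x \<in> carrier_vec n" for x s
    proof -
      let ?e = "unit_vec n i :: real vec"
      have Pe: "P *\<^sub>v ?e = c"
        using Pc i by (intro eq_vecI) (auto simp: c_def)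
      have 1: "x \<bullet> (P *\<^sub>v ?e) = c \<bullet> x" unfolding Pe using x c by (rule comm_scalar_prod)
      have 2: "?e \<bullet> (P *\<^sub>v x) = c \<bullet> x"
        using quad_sym[OF Pc Pt x, of ?e] 1 by simp
      have 3: "?e \<bullet> (P *\<^sub>v ?e) = p"
        unfolding Pe using i c Pc by (simp add: c_def p_def)
      have "0 \<le> (x + s \<cdot>\<^sub>v ?e) \<bullet> (P *\<^sub>v (x + s \<cdot>\<^sub>v ?e))"
        using P x by (simp add: pos_semidef_mat_def)
      also have "P *\<^sub>v (x + s \<cdot>\<^sub>v ?e) = P *\<^sub>v x + s \<cdot>\<^sub>v (P *\<^sub>v ?e)"
        using Pc x by (simp add: mult_add_distrib_mat_vec[OF Pc] mult_mat_vec[OF Pc])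
      also have "(x + s \<cdot>\<^sub>v ?e) \<bullet> \<dots> =
          x \<bullet> (P *\<^sub>v x) + s * (x \<bullet> (P *\<^sub>v ?e)) + s * (?e \<bullet> (P *\<^sub>v x)) + s * s * (?e \<bullet> (P *\<^sub>v ?e))"
        using Pc x by (simp add: add_scalar_prod_distrib[of _ n] scalar_prod_add_distrib[of _ n] algebra_simps
            del: scalar_prod_left_unit)
      finally show ?thesis unfolding 1 2 3 by (simp add: power2_eq_square)
    qed
    obtain j where j: "j < n" "c $ j \<noteq> 0"
      using i c by (metis c_def carrier_vecD eq_vecI index_zero_vec)
    have "p \<noteq> 0"
    proof
      assume "p = 0"
      have "c \<bullet> unit_vec n j = c $ j" using c j by simp
      moreover have "0 \<le> P $$ (j, j) + 2 * s * (c \<bullet> unit_vec n j)" for s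
        using shift[of "unit_vec n j" s] \<open>p = 0\<close> Pc j by simp
      \<comment> \<open>With a zero pivot the quadratic is affine in \<open>s\<close> with nonzero
        slope; this \<open>s\<close> brings it down to -1.\<close>
      from this[of "- (P $$ (j, j) + 1) / (2 * c $ j)"]
      have "0 \<le> P $$ (j, j) + 2 * (- (P $$ (j, j) + 1) / (2 * c $ j)) * c $ j"
        using \<open>c \<bullet> unit_vec n j = c $ j\<close> by simp
      ultimately show False using j by (simp add: field_simps)
    qed
    moreover have "0 \<le> p"
      using shift[of "0\<^sub>v n" 1] c Pc by simp
    ultimately have p: "0 < p" by simp
    define y where "y = (1 / sqrt p) \<cdot>\<^sub>v c"
    have y: "y \<in> carrier_vec n" using c by (simp add: y_def)
    define R where "R = P - outer_prod y y"
    have Rc: "R \<in> carrier_mat n n" using minus_carrier_mat[OF outer_prod_carrier[OF y y]] by (simp add: R_def)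
    have Rij: "R $$ (a, b) = P $$ (a, b) - c $ a * c $ b / p" if "a < n" "b < n" for a b
      using that Pc c p by (simp add: R_def y_def outer_prod_def flip: power2_eq_square)
    have R: "pos_semidef_mat n R"
      unfolding pos_semidef_mat_def
    proof (intro conjI ballI)
      show "transpose_mat R = R"
        using Pt Pc y by (simp add: R_def transpose_minus[of _ n n])
      fix x :: "real vec" assume x: "x \<in> carrier_vec n"
      have "x \<bullet> (R *\<^sub>v x) = x \<bullet> (P *\<^sub>v x) - (c \<bullet> x)\<^sup>2 / p"
        using x Pc y c p by (simp add: R_def quad_minus[of _ n] quad_outer_prod y_def power_mult_distrib power_divide)
      \<comment> \<open>The choice \<open>s = - (c \<bullet> x) / p\<close> minimises the quadratic,
        which is the Cauchy-Schwarz inequality for \<open>P\<close>.\<close>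
      moreover have "0 \<le> x \<bullet> (P *\<^sub>v x) - (c \<bullet> x)\<^sup>2 / p"
        using shift[OF x, of "- (c \<bullet> x) / p"] p by (simp add: power2_eq_square field_simps)
      ultimately show "0 \<le> x \<bullet> (R *\<^sub>v x)" by simp
    qed (rule Rc)
    have coli: "col R i = 0\<^sub>v n"
      using Rc Rij i p c Pc by (intro eq_vecI) (auto simp: c_def p_def)
    have colj: "col R l = 0\<^sub>v n" if l: "l < n" "col P l = 0\<^sub>v n" for l
    proof (intro eq_vecI)
      fix a assume "a < dim_vec (0\<^sub>v n :: real vec)"
      hence a: "a < n" by simp
      have z: "P $$ (b, l) = 0" if "b < n" for b
        using l Pc that by (metis carrier_matD index_col index_zero_vec(1))
      have "c $ l = 0" using z[OF i(1)] sym[OF i(1) l(1)] l i Pc by (simp add: c_def)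
      thus "col R l $ a = 0\<^sub>v n $ a" using Rc Rij a l z by simp
    qed (use Rc in simp)
    have "{l. l < n \<and> col R l \<noteq> 0\<^sub>v n} \<subset> {l. l < n \<and> col P l \<noteq> 0\<^sub>v n}"
      using coli colj i by blast
    hence "card {l. l < n \<and> col R l \<noteq> 0\<^sub>v n} < card {l. l < n \<and> col P l \<noteq> 0\<^sub>v n}"
      by (intro psubset_card_mono) auto
    hence "Q R" using less.hyps R by blast
    moreover have "P = R + outer_prod y y"
      using Pc y by (intro eq_matI) (auto simp: R_def outer_prod_def)
    ultimately show ?thesis using add[OF R y] by simp
  qed
qed

text \<open>\<open>P\<close> is built up from outer products. Each of them can only raise the
  determinant, and the partial sums stay positive definite.\<close>

lemma det_mono_pos_semidef:
  assumes A: "pos_def_mat n A" and P: "pos_semidef_mat n P"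
  shows "det A \<le> det (A + P)"
  using P
proof (induction rule: pos_semidef_induct)
  case zero
  show ?case using A by (simp add: pos_def_mat_def)
next
  case (add P y)
  have "A + (P + outer_prod y y) = A + P + outer_prod y y"
    using A add by (subst assoc_add_mat[of _ n n]) (auto simp: pos_def_mat_def pos_semidef_mat_def)
  thus ?case
    using add det_add_rank_one_ge[OF pos_def_add_semidef[OF A add.hyps(1)] add.hyps(2)] by simp
qed

section \<open>Gram determinants under row weights\<close>

lemma congruence_mat_diag_index:
  fixes f :: "nat \<Rightarrow> real"
  assumes "Y \<in> carrier_mat n k" "i < k" "j < k"
  shows "(transpose_mat Y * mat_diag n f * Y) $$ (i, j) = (\<Sum>l<n. f l * Y $$ (l, i) * Y $$ (l, j))"
  using assms
  by (simp add: mat_diag_mult_right[of _ k] scalar_prod_def atLeast0LessThan ac_simps)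

text \<open>The weights are switched on one row at a time. A row enters the Gram matrix through a
  single outer product, so its weight costs at most the factor \<open>d i\<close>; injectivity of
  \<open>Y\<close> keeps the intermediate matrices positive definite.\<close>

lemma det_gram_scale_rows_ge:
  fixes d :: "nat \<Rightarrow> real"
  assumes Y: "Y \<in> carrier_mat n k"
    and inj: "\<And>v. v \<in> carrier_vec k \<Longrightarrow> Y *\<^sub>v v = 0\<^sub>v n \<Longrightarrow> v = 0\<^sub>v k"
    and d: "\<And>i. i < n \<Longrightarrow> 0 < d i" "\<And>i. i < n \<Longrightarrow> d i \<le> 1"
  shows "(\<Prod>i<n. d i) * det (transpose_mat Y * Y) \<le> det (transpose_mat Y * mat_diag n d * Y)"
proof -
  define F where "F f = transpose_mat Y * mat_diag n f * Y" for f :: "nat \<Rightarrow> real"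
  have Fc: "F f \<in> carrier_mat k k" for f
    using Y unfolding F_def by (intro mult_carrier_mat[of _ k n] mult_carrier_mat[of _ k n _ n]) auto
  have Fij: "F f $$ (i, j) = (\<Sum>l<n. f l * Y $$ (l, i) * Y $$ (l, j))" if "i < k" "j < k" for f i j
    unfolding F_def using Y that by (rule congruence_mat_diag_index)
  \<comment> \<open>\<open>g m\<close> weights only the first \<open>m\<close> rows, interpolating
    between the plain Gram matrix at \<open>m = 0\<close> and the weighted one at
    \<open>m = n\<close>.\<close>
  define g where "g m i = (if i < m then d i else 1)" for m i
  have "(\<Prod>i<m. d i) * det (F (\<lambda>_. 1)) \<le> det (F (g m))" if "m \<le> n" for m
    using that
  proof (induction m)
    case 0
    have "g 0 = (\<lambda>_. 1)" by (auto simp: g_def)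
    thus ?case by simp
  next
    case (Suc m)
    hence m: "m < n" by simp
    have y: "row Y m \<in> carrier_vec k" using Y m by simp
    \<comment> \<open>Row \<open>m\<close> is isolated: \<open>c = 0\<close> gives the semidefinite
      remainder, \<open>c = 1\<close> the current matrix and \<open>c = d m\<close> the next
      one.\<close>
    have split: "F ((g m)(m := c)) = F ((g m)(m := 0)) + c \<cdot>\<^sub>m outer_prod (row Y m) (row Y m)" for c
    proof (rule eq_matI)
      fix i j
      assume "i < dim_row (F ((g m)(m := 0)) + c \<cdot>\<^sub>m outer_prod (row Y m) (row Y m))"
        "j < dim_col (F ((g m)(m := 0)) + c \<cdot>\<^sub>m outer_prod (row Y m) (row Y m))"
      hence ij: "i < k" "j < k" using Y by (auto simp: outer_prod_def)
      have "(\<Sum>l<n. ((g m)(m := c)) l * Y $$ (l, i) * Y $$ (l, j)) =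
        (\<Sum>l<n. ((g m)(m := 0)) l * Y $$ (l, i) * Y $$ (l, j)) + c * (Y $$ (m, i) * Y $$ (m, j))"
        using m by (simp add: sum.remove[of _ m])
      thus "F ((g m)(m := c)) $$ (i, j) =
        (F ((g m)(m := 0)) + c \<cdot>\<^sub>m outer_prod (row Y m) (row Y m)) $$ (i, j)"
        using Y ij m Fc by (simp add: Fij outer_prod_def)
    qed (use Y in \<open>auto simp: F_def outer_prod_def\<close>)
    have psd: "pos_semidef_mat k (F ((g m)(m := 0)))"
      unfolding F_def using d by (intro pos_semidef_congruence[OF pos_semidef_mat_diag Y])
        (auto simp: g_def intro: less_imp_le)
    have g1: "(g m)(m := 1) = g m" and g2: "(g m)(m := d m) = g (Suc m)"
      by (auto simp: g_def)
    have one: "1 \<cdot>\<^sub>m outer_prod (row Y m) (row Y m) = outer_prod (row Y m) (row Y m)"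
      by (intro eq_matI) auto
    have gm: "F ((g m)(m := 0)) + outer_prod (row Y m) (row Y m) = F (g m)"
      using split[of 1] unfolding g1 one by simp
    have "pos_def_mat k (F (g m))"
      unfolding F_def using d by (intro pos_def_congruence[OF pos_def_mat_diag Y inj]) (auto simp: g_def)
    from det_scale_rank_one_ge(2)[OF psd y, unfolded gm, OF this d[OF m]]
    have "d m * det (F (g m)) \<le> det (F (g (Suc m)))"
      using split[of "d m"] unfolding g2 by simp
    moreover have "d m * ((\<Prod>i<m. d i) * det (F (\<lambda>_. 1))) \<le> d m * det (F (g m))"
      using Suc d(1)[OF m] by (intro mult_left_mono) auto
    ultimately show ?case by (simp add: ac_simps)
  qed
  from this[of n] have "(\<Prod>i<n. d i) * det (F (\<lambda>_. 1)) \<le> det (F (g n))" by simp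
  moreover have "F (\<lambda>_. 1) = transpose_mat Y * Y" using Y by (simp add: F_def)
  moreover have "mat_diag n (g n) = mat_diag n d" by (intro eq_matI) (auto simp: mat_diag_def g_def)
  ultimately show ?thesis by (simp add: F_def)
qed

section \<open>Perturbations of bounded rank\<close>

text \<open>The columns of \<open>Y\<close> form a maximal independent set of columns of
  \<open>B\<close>. Maximality expresses every column of \<open>B\<close> through them, which gives
  \<open>Z\<close>; independence gives the injectivity of \<open>Y\<close>.\<close>

lemma rank_factorization:
  fixes B :: "real mat"
  assumes B: "B \<in> carrier_mat n k"
  obtains Y Z where "Y \<in> carrier_mat n (vec_space.rank n B)" "Z \<in> carrier_mat (vec_space.rank n B) k"
    "B = Y * Z"
    "\<And>v. v \<in> carrier_vec (vec_space.rank n B) \<Longrightarrow> Y *\<^sub>v v = 0\<^sub>v n \<Longrightarrow> v = 0\<^sub>v (vec_space.rank n B)"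
proof -
  interpret vec_space "TYPE(real)" n .
  let ?S = "set (cols B)"
  have S: "?S \<subseteq> carrier_vec n" using cols_dim B by blast
  obtain U where U: "finite U" "maximal U (\<lambda>T. T \<subseteq> ?S \<and> lin_indpt T)"
    using maximal_exists_superset[of ?S "\<lambda>T. T \<subseteq> ?S \<and> lin_indpt T" "{}"]
    by (auto simp: lin_dep_def)
  have US: "U \<subseteq> ?S" "lin_indpt U" using U(2) by (auto simp: maximal_def)
  have Uc: "U \<subseteq> carrier_vec n" using US S by blast
  obtain us where us: "set us = U" "distinct us" using finite_distinct_list[OF U(1)] by blast
  have r: "rank B = length us"
    using rank_card_indpt[OF B U(2)] us distinct_card by metis
  define Y where "Y = mat_of_cols n us"
  have Yc: "Y \<in> carrier_mat n (rank B)" by (simp add: Y_def r)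
  have colsY: "cols Y = us" using us Uc by (simp add: Y_def)
  have "\<exists>z. z \<in> carrier_vec (rank B) \<and> Y *\<^sub>v z = s" if s: "s \<in> ?S" for s
  proof -
    have "s \<in> span U"
    proof (rule ccontr)
      assume "s \<notin> span U"
      hence "lin_indpt (U \<union> {s})" "s \<notin> U"
        using lin_dep_iff_in_span[OF Uc US(2), of s] s S in_own_span[OF Uc] by auto
      thus False using U(2) s US unfolding maximal_def
        by (metis Un_insert_right Un_upper1 insert_subset sup_bot_right)
    qed
    then obtain a where "s = lincomb a U" using finite_span[OF U(1) Uc] by auto
    hence "Y *\<^sub>v vec (rank B) (\<lambda>i. a (col Y i)) = s"
      using mat_mult_eq_lincomb[OF Yc, of a] us colsY by simp
    thus ?thesis by (intro exI[of _ "vec (rank B) (\<lambda>i. a (col Y i))"]) auto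
  qed
  then obtain z where z: "\<And>s. s \<in> ?S \<Longrightarrow> z s \<in> carrier_vec (rank B)" "\<And>s. s \<in> ?S \<Longrightarrow> Y *\<^sub>v z s = s"
    by metis
  define Z where "Z = mat_of_cols (rank B) (map z (cols B))"
  have Zc: "Z \<in> carrier_mat (rank B) k"
    unfolding Z_def using B mat_of_cols_carrier(1)[of "rank B" "map z (cols B)"] by simp
  have "B = Y * Z"
  proof (rule mat_col_eqI)
    fix j assume "j < dim_col (Y * Z)"
    hence j: "j < k" using Zc by simp
    have "col Z j = z (col B j)"
      using j B z by (simp add: Z_def col_mat_of_cols cols_def)
    moreover have "col (Y * Z) j = Y *\<^sub>v col Z j" using Yc Zc j by (rule col_mult2)
    ultimately show "col B j = col (Y * Z) j"
      using z(2)[of "col B j"] j B by (auto simp: cols_def)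
  qed (use B Yc Zc in auto)
  moreover have "v = 0\<^sub>v (rank B)" if "v \<in> carrier_vec (rank B)" "Y *\<^sub>v v = 0\<^sub>v n" for v
    using lin_depI[OF Yc that(1) _ that(2)] us US colsY by auto
  ultimately show ?thesis using that Yc Zc by blast
qed

text \<open>Since \<open>Y^T (1 - Y X) Y = Y^T Y (1 - X Y)\<close>, Sylvester's identity moves the
  determinant from size \<open>n\<close> to size \<open>k\<close>, where only the form of
  \<open>1 - Y X\<close> on the range of \<open>Y\<close> matters.\<close>

lemma det_one_minus_mult_gram:
  fixes X Y :: "real mat"
  assumes Y: "Y \<in> carrier_mat n k" and X: "X \<in> carrier_mat k n"
  shows "det (1\<^sub>m n - Y * X) * det (transpose_mat Y * Y) = det (transpose_mat Y * (1\<^sub>m n - Y * X) * Y)"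
proof -
  let ?T = "transpose_mat Y"
  have T: "?T \<in> carrier_mat k n" using Y by simp
  have YX: "Y * X \<in> carrier_mat n n" and XY: "X * Y \<in> carrier_mat k k"
    and TY: "?T * Y \<in> carrier_mat k k"
    using X Y by auto
  have XYY: "?T * (Y * X) * Y = ?T * Y * (X * Y)"
    using X Y T YX
    by (simp add: assoc_mult_mat[OF T YX Y] assoc_mult_mat[OF Y X Y] assoc_mult_mat[OF T Y XY])
  have "?T * (1\<^sub>m n - Y * X) * Y = ?T * Y * (1\<^sub>m k - X * Y)"
    using T Y XYY
    by (simp add: mult_minus_distrib_mat[OF T one_carrier_mat YX]
        minus_mult_distrib_mat[OF T mult_carrier_mat[OF T YX] Y]
        mult_minus_distrib_mat[OF TY one_carrier_mat XY])
  thus ?thesis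
    using det_mult[OF TY minus_carrier_mat[OF XY]] det_one_minus_mult_commute[OF Y X] by simp
qed

text \<open>A perturbation of rank \<open>k\<close> can lower at most \<open>k\<close> directions,
  so only \<open>k\<close> factors appear. Compression by \<open>Y\<close> reduces the claim to Gram
  determinants, whose common positive factor is cancelled at the end.\<close>

lemma det_low_rank_perturbation_ge:
  fixes e :: "nat \<Rightarrow> real"
  assumes Y: "Y \<in> carrier_mat n k" and Z: "Z \<in> carrier_mat k l" and kn: "k \<le> n"
    and inj: "\<And>v. v \<in> carrier_vec k \<Longrightarrow> Y *\<^sub>v v = 0\<^sub>v n \<Longrightarrow> v = 0\<^sub>v k"
    and e: "\<And>i. i < n \<Longrightarrow> 0 < e i" "\<And>i j. i \<le> j \<Longrightarrow> j < n \<Longrightarrow> e i \<le> e j"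
    and psd: "pos_semidef_mat n (1\<^sub>m n - (Y * Z) * transpose_mat (Y * Z) - mat_diag n e)"
  shows "(\<Prod>i<k. e i) \<le> det (1\<^sub>m n - (Y * Z) * transpose_mat (Y * Z))"
proof -
  \<comment> \<open>The grouping exposes \<open>Y\<close> as the left factor of the whole
    perturbation, as the Gram identity requires.\<close>
  define X where "X = Z * (transpose_mat Z * transpose_mat Y)"
  define M where "M = 1\<^sub>m n - Y * X"
  have X: "X \<in> carrier_mat k n" using Y Z by (simp add: X_def)
  have YX: "Y * X \<in> carrier_mat n n" using Y X by simp
  have "(Y * Z) * transpose_mat (Y * Z) = Y * X"
    using Y Z by (simp add: X_def transpose_mult[OF Y Z] assoc_mult_mat[of _ n k _ l _ n])
  hence M: "1\<^sub>m n - (Y * Z) * transpose_mat (Y * Z) = M" by (simp add: M_def)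
  have Mc: "M \<in> carrier_mat n n" using YX by (simp add: M_def minus_carrier_mat)
  let ?T = "transpose_mat Y"
  let ?G = "?T * Y"
  have T: "?T \<in> carrier_mat k n" using Y by simp
  have det: "det M * det ?G = det (?T * M * Y)"
    unfolding M_def using Y X by (rule det_one_minus_mult_gram)
  have "pos_def_mat k (?T * mat_diag n (\<lambda>_. 1) * Y)"
    by (intro pos_def_congruence[OF pos_def_mat_diag Y inj]) auto
  hence G: "0 < det ?G" using pos_def_det_pos Y by (simp add: right_mult_one_mat[OF T])
  have "(\<Prod>i<k. e i) * det ?G \<le> det M * det ?G"
  proof (cases "k = 0")
    \<comment> \<open>For \<open>k = 0\<close> there is no last entry \<open>e (k - 1)\<close>; both
      compressed matrices are of size 0 and have determinant 1.\<close>
    case True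
    have "?G \<in> carrier_mat 0 0" "?T * M * Y \<in> carrier_mat 0 0" using True Y Mc by auto
    thus ?thesis using det True by simp
  next
    case False
    \<comment> \<open>As \<open>e\<close> is increasing, \<open>c\<close> is the largest of its
      first \<open>k\<close> entries, and \<open>c * d i\<close> is the minimum of
      \<open>e i\<close> and \<open>c\<close>.\<close>
    define c where "c = e (k - 1)"
    define d where "d i = (if i < k then e i / c else 1)" for i
    have c: "0 < c" using e(1)[of "k - 1"] False kn by (simp add: c_def)
    have d: "0 < d i" "d i \<le> 1" if "i < n" for i
      using e that c False kn by (auto simp: d_def c_def)
    have le: "c * d i \<le> e i" if "i < n" for i
      using e(2)[of "k - 1" i] that c by (auto simp: d_def c_def)
    let ?D = "mat_diag n (\<lambda>i. c * d i)"
    have D: "?D = c \<cdot>\<^sub>m mat_diag n d" by (intro eq_matI) (auto simp: mat_diag_def)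
    \<comment> \<open>\<open>M\<close> dominates \<open>mat_diag n e\<close> by hypothesis, and the
      latter dominates the truncation \<open>?D\<close> entrywise.\<close>
    have "pos_semidef_mat n (M - mat_diag n e + mat_diag n (\<lambda>i. e i - c * d i))"
      using le psd unfolding M by (intro pos_semidef_add pos_semidef_mat_diag) auto
    also have "M - mat_diag n e + mat_diag n (\<lambda>i. e i - c * d i) = M - ?D"
      using Mc by (intro eq_matI) (auto simp: mat_diag_def)
    finally have "pos_semidef_mat k (?T * (M - ?D) * Y)"
      using Y by (rule pos_semidef_congruence)
    moreover have "pos_def_mat k (?T * ?D * Y)"
      using d c by (intro pos_def_congruence[OF pos_def_mat_diag Y inj]) auto
    ultimately have "det (?T * ?D * Y) \<le> det (?T * ?D * Y + ?T * (M - ?D) * Y)"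
      by (intro det_mono_pos_semidef)
    also have "?T * ?D * Y + ?T * (M - ?D) * Y = ?T * (?D + (M - ?D)) * Y"
    proof -
      have MD: "M - ?D \<in> carrier_mat n n" by (simp add: minus_carrier_mat)
      show ?thesis
        by (simp add: mult_add_distrib_mat[OF T mat_diag_dim MD]
            add_mult_distrib_mat[OF mult_carrier_mat[OF T mat_diag_dim] mult_carrier_mat[OF T MD] Y])
    qed
    also have "?D + (M - ?D) = M" using Mc by (intro eq_matI) (auto simp: mat_diag_def)
    finally have upper: "det (?T * ?D * Y) \<le> det M * det ?G" using det by simp
    have "?T * ?D * Y = c \<cdot>\<^sub>m (?T * mat_diag n d * Y)"
      unfolding D
      by (simp add: mult_smult_distrib[OF T mat_diag_dim]
          mult_smult_assoc_mat[OF mult_carrier_mat[OF T mat_diag_dim] Y])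
    hence "det (?T * ?D * Y) = det (c \<cdot>\<^sub>m (?T * mat_diag n d * Y))" by (rule arg_cong)
    also have "\<dots> = c ^ k * det (?T * mat_diag n d * Y)"
      using Y by (simp add: carrier_matD(2)[OF Y])
    finally have scale: "det (?T * ?D * Y) = c ^ k * det (?T * mat_diag n d * Y)" .
    have lower: "c ^ k * ((\<Prod>i<n. d i) * det ?G) \<le> c ^ k * det (?T * mat_diag n d * Y)"
      using c d by (intro mult_left_mono det_gram_scale_rows_ge[OF Y inj]) auto
    \<comment> \<open>The weights from index \<open>k\<close> on are 1, so \<open>c ^ k\<close>
      cancels exactly the \<open>k\<close> divisions by \<open>c\<close>.\<close>
    have prod: "c ^ k * (\<Prod>i<n. d i) = (\<Prod>i<k. e i)"
    proof -
      have "(\<Prod>i<n. d i) = (\<Prod>i<k. d i)"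
        using kn by (intro prod.mono_neutral_right) (auto simp: d_def)
      also have "\<dots> = (\<Prod>i<k. e i / c)" by (intro prod.cong) (auto simp: d_def)
      finally show ?thesis using c by (simp add: prod_dividef)
    qed
    have "(\<Prod>i<k. e i) * det ?G = c ^ k * ((\<Prod>i<n. d i) * det ?G)"
      unfolding prod[symmetric] by (rule mult.assoc)
    also note lower
    also note scale[symmetric]
    also note upper
    finally show ?thesis .
  qed
  thus ?thesis unfolding M using G by simp
qed

section \<open>Determinant bound on the approximation class\<close>

lemma congruence_minus:
  fixes T :: "real mat"
  assumes T: "T \<in> carrier_mat n n" and A: "A \<in> carrier_mat n n" and B: "B \<in> carrier_mat n n"
  shows "T * (A - B) * transpose_mat T = T * A * transpose_mat T - T * B * transpose_mat T"
  using assms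
  by (simp add: mult_minus_distrib_mat[OF T A B] minus_mult_distrib_mat[of _ n n _ _ n])

lemma det_congruence:
  fixes T :: "real mat"
  assumes T: "T \<in> carrier_mat n n" and A: "A \<in> carrier_mat n n"
  shows "det (T * A * transpose_mat T) = (det T)\<^sup>2 * det A"
  using assms by (simp add: det_mult[of _ n] det_transpose power2_eq_square)

lemma det_mat_diag: "det (mat_diag n f) = (\<Prod>i<n. f i :: real)"
  by (subst det_upper_triangular[of _ n])
     (auto simp: mat_diag_def prod_list_diag_prod atLeast0LessThan)

text \<open>Congruence by the inverse of \<open>T\<close> turns the prior into the identity and the
  posterior into \<open>mat_diag n e\<close>. It scales all determinants by the same factor, so the
  bound for low-rank perturbations of the identity carries over.\<close>

lemma det_approx_class_ge:
  fixes e :: "nat \<Rightarrow> real"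
  assumes T: "T \<in> carrier_mat n n" and U: "U \<in> carrier_mat n n" and TU: "T * U = 1\<^sub>m n"
    and r: "r \<le> n"
    and e: "\<And>i. i < n \<Longrightarrow> 0 < e i" "\<And>i. i < n \<Longrightarrow> e i \<le> 1"
      "\<And>i j. i \<le> j \<Longrightarrow> j < n \<Longrightarrow> e i \<le> e j"
    and \<Gamma>: "\<Gamma> \<in> approx_class n r (T * transpose_mat T) (T * mat_diag n e * transpose_mat T)"
  shows "(det T)\<^sup>2 * (\<Prod>i<r. e i) \<le> det \<Gamma>"
proof -
  let ?P = "T * mat_diag n e * transpose_mat T"
  obtain l B where B: "B \<in> carrier_mat n l" and \<Gamma>_eq: "\<Gamma> = T * transpose_mat T - B * transpose_mat B"
    and psd: "pos_semidef_mat n (\<Gamma> - ?P)" and rank: "vec_space.rank n B \<le> r"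
    using \<Gamma> by (auto simp: approx_class_def)
  define k where "k = vec_space.rank n B"
  obtain Y Z where Y: "Y \<in> carrier_mat n k" and Z: "Z \<in> carrier_mat k l" and BYZ: "B = Y * Z"
    and inj: "\<And>v. v \<in> carrier_vec k \<Longrightarrow> Y *\<^sub>v v = 0\<^sub>v n \<Longrightarrow> v = 0\<^sub>v k"
    using rank_factorization[OF B] unfolding k_def by blast
  have UT: "U * T = 1\<^sub>m n" using T U TU by (rule mat_mult_left_right_inverse)
  \<comment> \<open>\<open>C\<close> is \<open>B\<close> in the new coordinates, kept in factored
    form; \<open>U * Y\<close> inherits injectivity from \<open>Y\<close>.\<close>
  define C where "C = (U * Y) * Z"
  have UY: "U * Y \<in> carrier_mat n k" using U Y by simp
  have C: "C \<in> carrier_mat n l" using UY Z by (simp add: C_def)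
  have TC: "T * C = B"
    using T U Y Z TU by (simp add: C_def BYZ assoc_mult_mat[OF U Y Z] flip: assoc_mult_mat[OF T U mult_carrier_mat[OF Y Z]])
  have CC: "C * transpose_mat C \<in> carrier_mat n n" using C by simp
  define M where "M = 1\<^sub>m n - C * transpose_mat C"
  have M: "M \<in> carrier_mat n n" using CC by (simp add: M_def minus_carrier_mat)
  have Tt: "transpose_mat T \<in> carrier_mat n n" and Ct: "transpose_mat C \<in> carrier_mat l n" using T C by auto
  have "T * (C * transpose_mat C) * transpose_mat T = B * transpose_mat B"
    unfolding TC[symmetric] transpose_mult[OF T C]
    by (simp add: assoc_mult_mat[OF T CC Tt] assoc_mult_mat[OF C Ct Tt]
        assoc_mult_mat[OF T C mult_carrier_mat[OF Ct Tt]])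
  hence \<Gamma>M: "\<Gamma> = T * M * transpose_mat T"
    unfolding M_def congruence_minus[OF T one_carrier_mat CC] \<Gamma>_eq using T by simp
  have MD: "M - mat_diag n e \<in> carrier_mat n n" by (simp add: minus_carrier_mat)
  have N: "\<Gamma> - ?P = T * (M - mat_diag n e) * transpose_mat T"
    unfolding \<Gamma>M by (rule congruence_minus[OF T M mat_diag_dim, symmetric])
  have "pos_semidef_mat n (transpose_mat (transpose_mat U) * (\<Gamma> - ?P) * transpose_mat U)"
    using U by (intro pos_semidef_congruence[OF psd]) auto
  also have "transpose_mat (transpose_mat U) * (\<Gamma> - ?P) * transpose_mat U = M - mat_diag n e"
  proof -
    have Ut: "transpose_mat U \<in> carrier_mat n n" using U by simp
    have 1: "transpose_mat T * transpose_mat U = 1\<^sub>m n"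
      using transpose_mult[OF U T] UT by simp
    have "U * (T * (M - mat_diag n e) * transpose_mat T) * transpose_mat U
      = (U * T) * (M - mat_diag n e) * (transpose_mat T * transpose_mat U)"
      using T U MD Tt Ut by (simp add: assoc_mult_mat[of _ n n _ n _ n])
    also have "\<dots> = M - mat_diag n e"
      unfolding UT 1 left_mult_one_mat[OF MD] right_mult_one_mat[OF MD] ..
    finally show ?thesis unfolding N by simp
  qed
  finally have psdM: "pos_semidef_mat n (M - mat_diag n e)" .
  have inj': "v = 0\<^sub>v k" if v: "v \<in> carrier_vec k" "(U * Y) *\<^sub>v v = 0\<^sub>v n" for v
  proof -
    have "Y *\<^sub>v v = (T * U) *\<^sub>v (Y *\<^sub>v v)" unfolding TU using Y v by simp
    also have "\<dots> = T *\<^sub>v ((U * Y) *\<^sub>v v)" using T U Y v by simp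
    also have "\<dots> = 0\<^sub>v n" unfolding v(2) using T by (intro eq_vecI) auto
    finally show ?thesis using inj v by blast
  qed
  have kr: "k \<le> r" using rank by (simp add: k_def)
  have "(\<Prod>i<r. e i) = (\<Prod>i<k. e i) * (\<Prod>i=k..<r. e i)"
    using kr by (simp add: prod.union_disjoint[symmetric] ivl_disj_un ivl_disj_int flip: atLeast0LessThan)
  \<comment> \<open>The rank \<open>k\<close> of \<open>B\<close> may be smaller than
    \<open>r\<close>; the additional factors are at most 1.\<close>
  also have "\<dots> \<le> (\<Prod>i<k. e i) * 1"
    using e kr r by (intro mult_left_mono prod_le_1 prod_nonneg) (auto intro: less_imp_le)
  also have "\<dots> \<le> det M"
    unfolding mult_1_right M_def C_def
    by (rule det_low_rank_perturbation_ge[OF UY Z order_trans[OF kr r] _ _ _ psdM[unfolded M_def C_def]])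
      (use inj' e in blast)+
  finally have "(det T)\<^sup>2 * (\<Prod>i<r. e i) \<le> (det T)\<^sup>2 * det M" by (rule mult_left_mono) simp
  thus ?thesis unfolding \<Gamma>M det_congruence[OF T M] .
qed

section \<open>Inverses and sums of matrices\<close>

text \<open>A right inverse forces a nonzero determinant, so \<open>mat_inverse\<close> does return
  a value, and the inverse it returns must agree with \<open>X\<close>.\<close>

lemma mat_inv_eqI:
  assumes A: "A \<in> carrier_mat n n" and X: "X \<in> carrier_mat n n" and AX: "A * X = 1\<^sub>m n"
  shows "mat_inv A = X"
proof -
  have "det A \<noteq> 0" using det_mult[OF A X] AX by auto
  hence "A \<in> Units (ring_mat TYPE(real) n ())" using A by (intro det_non_zero_imp_unit)
  then obtain B where B: "mat_inverse A = Some B"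
    using mat_inverse(1)[OF A, of "()"] by (cases "mat_inverse A") auto
  have *: "B * A = 1\<^sub>m n" "B \<in> carrier_mat n n" using mat_inverse(2)[OF A B] by auto
  have "B = B * (A * X)" unfolding AX using * by simp
  also have "\<dots> = X" using * A X by (simp flip: assoc_mult_mat)
  finally show ?thesis using B by simp
qed

lemma mat_inv_carrier:
  assumes "pos_def_mat n A"
  shows "mat_inv A \<in> carrier_mat n n"
proof -
  have A: "A \<in> carrier_mat n n" using assms by (simp add: pos_def_mat_def)
  obtain B where "B \<in> carrier_mat n n" "A * B = 1\<^sub>m n"
    using det_non_zero_imp_unit[OF A pos_def_det_nonzero[OF assms], of undefined]
    by (auto simp: Units_def ring_mat_def)
  thus ?thesis using mat_inv_eqI[OF A] by simp
qed

text \<open>Makes the abstract sum in \<open>opt_cov\<close> accessible entry by entry, so that it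
  can be compared with a matrix product.\<close>

lemma finsum_module_mat:
  assumes "finite I" "\<And>i. i \<in> I \<Longrightarrow> f i \<in> carrier_mat n k"
  shows "(\<Oplus>\<^bsub>module_mat TYPE(real) n k\<^esub> i \<in> I. f i) = mat n k (\<lambda>(a, b). \<Sum>i\<in>I. f i $$ (a, b))"
  using assms
proof (induction rule: finite_induct)
  interpret vectorspace class_ring "module_mat TYPE(real) n k" by (rule matrix_vs)
  case empty
  show ?case by (simp add: finsum_empty module_mat_simps) (auto intro!: eq_matI)
next
  interpret vectorspace class_ring "module_mat TYPE(real) n k" by (rule matrix_vs)
  case (insert i I)
  have "f \<in> I \<rightarrow> carrier (module_mat TYPE(real) n k)" "f i \<in> carrier (module_mat TYPE(real) n k)"
    using insert by (auto simp: module_mat_def)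
  hence "(\<Oplus>\<^bsub>module_mat TYPE(real) n k\<^esub> i \<in> insert i I. f i) = f i + (\<Oplus>\<^bsub>module_mat TYPE(real) n k\<^esub> i \<in> I. f i)"
    using insert by (subst finsum_insert) (auto simp: module_mat_def)
  thus ?case using insert by (auto intro!: eq_matI)
qed

section \<open>Optimality of the posterior covariance approximation\<close>

text \<open>The first objective is the distance between the exact and the approximate log-ratio, the
  second its simplified form. They agree on the class because all determinants involved are
  positive.\<close>

theorem theorem3p1:
  fixes m n r :: nat
    and G \<Gamma>pr \<Gamma>obs S \<Gamma>pos \<Gamma>star :: "real mat"
    and \<delta> :: "nat \<Rightarrow> real"
    and w :: "nat \<Rightarrow> real vec"
  assumes G: "G \<in> carrier_mat m n"
    and pr: "pos_def_mat n \<Gamma>pr"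
    and obs: "pos_def_mat m \<Gamma>obs"
    and S: "S \<in> carrier_mat n n" "\<Gamma>pr = S * transpose_mat S"
    and eig: "\<And>i. i \<in> {1..n} \<Longrightarrow> eigenvector (precond_hessian G \<Gamma>obs S) (w i) ((\<delta> i)\<^sup>2)"
    and ord: "\<And>i. i \<in> {1..<n} \<Longrightarrow> (\<delta> (i + 1))\<^sup>2 \<le> (\<delta> i)\<^sup>2"
    and orthonormal: "\<And>i j. i \<in> {1..n} \<Longrightarrow> j \<in> {1..n} \<Longrightarrow> w i \<bullet> w j = (if i = j then 1 else 0)"
    and r: "1 \<le> r" "r \<le> n"
    and pos: "\<Gamma>pos = posterior_cov G \<Gamma>obs \<Gamma>pr"
    and star: "\<Gamma>star = opt_cov n r \<Gamma>pr S \<delta> w"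
  shows "\<Gamma>star \<in> approx_class n r \<Gamma>pr \<Gamma>pos \<and>
     is_arg_min (\<lambda>\<Gamma>. \<bar>ln (det \<Gamma>pr / det \<Gamma>pos) - ln (det \<Gamma>pr / det \<Gamma>)\<bar>)
           (\<lambda>\<Gamma>. \<Gamma> \<in> approx_class n r \<Gamma>pr \<Gamma>pos) \<Gamma>star \<and>
     is_arg_min (\<lambda>\<Gamma>. \<bar>ln (det \<Gamma>pos / det \<Gamma>)\<bar>)
           (\<lambda>\<Gamma>. \<Gamma> \<in> approx_class n r \<Gamma>pr \<Gamma>pos) \<Gamma>star \<and>
     ln (det \<Gamma>pr / det \<Gamma>star) = (\<Sum>i = 1..r. ln (1 + (\<delta> i)\<^sup>2)) \<and>
     ln (det \<Gamma>star / det \<Gamma>pos) = (\<Sum>i = r + 1..n. ln (1 + (\<delta> i)\<^sup>2))"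
proof -
  \<comment> \<open>Eigenpairs are numbered from 1 and matrix entries from 0, hence the
    \<open>Suc\<close>.\<close>
  define D where "D = mat_diag n (\<lambda>i. (\<delta> (Suc i))\<^sup>2)"
  define e where "e i = 1 / (1 + (\<delta> (Suc i))\<^sup>2)" for i
  \<comment> \<open>In the coordinates of \<open>T\<close> below, \<open>f\<close> is the diagonal
    subtracted from the identity and \<open>s\<close> is what remains for
    \<open>\<Gamma>star\<close>.\<close>
  define f where "f i = (if i < r then (\<delta> (Suc i))\<^sup>2 / (1 + (\<delta> (Suc i))\<^sup>2) else 0)" for i
  define s where "s i = (if i < r then e i else 1)" for i
  have one: "0 < 1 + (\<delta> i)\<^sup>2" for i by (rule add_pos_nonneg) auto
  have sf: "s i = 1 - f i" for i
    using one[of "Suc i"] by (auto simp: s_def f_def e_def field_simps)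
  have e: "0 < e i" "e i \<le> 1" for i using one[of "Suc i"] by (auto simp: e_def)
  have e0: "e i \<noteq> 0" for i using e(1)[of i] by simp
  have antimono: "(\<delta> (Suc j))\<^sup>2 \<le> (\<delta> (Suc i))\<^sup>2" if "i \<le> j" "j < n" for i j
    using that
  proof (induction j rule: dec_induct)
    case (step j)
    thus ?case using ord[of "Suc j"] by simp
  qed simp
  have e_mono: "e i \<le> e j" if "i \<le> j" "j < n" for i j
    using antimono[OF that] one by (auto simp: e_def intro!: divide_left_mono mult_pos_pos)

  let ?H = "hessian G \<Gamma>obs"
  have H: "?H \<in> carrier_mat n n"
    unfolding hessian_def using G mat_inv_carrier[OF obs]
    by (intro mult_carrier_mat[of _ n m] mult_carrier_mat[of _ n m _ m]) auto
  have St: "transpose_mat S \<in> carrier_mat n n" using S by simp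
  let ?K = "precond_hessian G \<Gamma>obs S"
  have K: "?K \<in> carrier_mat n n"
    unfolding precond_hessian_def using H S by simp
  have w: "w i \<in> carrier_vec n" "?K *\<^sub>v w i = (\<delta> i)\<^sup>2 \<cdot>\<^sub>v w i" if "i \<in> {1..n}" for i
    using eig[OF that] K by (auto simp: eigenvector_def)

  define W where "W = mat n n (\<lambda>(i, j). w (Suc j) $ i)"
  have W: "W \<in> carrier_mat n n" by (simp add: W_def)
  have Wt: "transpose_mat W \<in> carrier_mat n n" by (simp add: W_def)
  have colW: "col W j = w (Suc j)" if "j < n" for j
    using that w(1)[of "Suc j"] by (intro eq_vecI) (auto simp: W_def)
  have WtW: "transpose_mat W * W = 1\<^sub>m n"
  proof (rule eq_matI)
    fix i j assume "i < dim_row (1\<^sub>m n :: real mat)" "j < dim_col (1\<^sub>m n :: real mat)"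
    thus "(transpose_mat W * W) $$ (i, j) = 1\<^sub>m n $$ (i, j)"
      using W orthonormal[of "Suc i" "Suc j"] by (simp add: colW)
  qed (use W in auto)
  have WWt: "W * transpose_mat W = 1\<^sub>m n"
    using Wt W WtW by (rule mat_mult_left_right_inverse)
  have Dc: "D \<in> carrier_mat n n" by (simp add: D_def)
  have KW: "?K * W = W * D"
  proof (rule mat_col_eqI)
    fix j assume "j < dim_col (W * D)"
    hence j: "j < n" using Dc by simp
    have "col (?K * W) j = (\<delta> (Suc j))\<^sup>2 \<cdot>\<^sub>v w (Suc j)"
      using j w(2)[of "Suc j"] by (simp add: col_mult2[OF K W j] colW)
    also have "\<dots> = col (W * D) j"
      using j w(1)[of "Suc j"] unfolding D_def mat_diag_mult_right[OF W]
      by (intro eq_vecI) (auto simp: W_def)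
    finally show "col (?K * W) j = col (W * D) j" .
  qed (use K W Dc in auto)

  \<comment> \<open>Simultaneous diagonalisation: in the coordinates given by \<open>T\<close> the
    prior covariance becomes the identity and the Hessian becomes \<open>D\<close>.\<close>
  define T where "T = S * W"
  have T: "T \<in> carrier_mat n n" using S W by (simp add: T_def)
  have Tt: "transpose_mat T \<in> carrier_mat n n" using T by simp
  have TTt: "T * transpose_mat T = \<Gamma>pr"
  proof -
    have "T * transpose_mat T = S * (W * transpose_mat W) * transpose_mat S"
      unfolding T_def transpose_mult[OF S(1) W] using S(1) W Wt St
      by (simp add: assoc_mult_mat[of _ n n _ n _ n])
    thus ?thesis unfolding WWt S(2) using S(1) by simp
  qed
  \<comment> \<open>Invertibility of \<open>T\<close> comes from that of
    \<open>\<Gamma>pr = T T^T\<close>.\<close>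
  have detT: "det T \<noteq> 0"
    using pos_def_det_nonzero[OF pr] det_mult[OF T Tt] by (simp add: TTt)
  then obtain U where U: "U \<in> carrier_mat n n" and TU: "T * U = 1\<^sub>m n"
    using det_non_zero_imp_unit[OF T, of undefined] by (auto simp: Units_def ring_mat_def)
  have UT: "U * T = 1\<^sub>m n" using T U TU by (rule mat_mult_left_right_inverse)
  have Ut: "transpose_mat U \<in> carrier_mat n n" using U by simp
  have TtUt: "transpose_mat T * transpose_mat U = 1\<^sub>m n"
    using transpose_mult[OF U T] UT by simp
  have UtTt: "transpose_mat U * transpose_mat T = 1\<^sub>m n"
    using transpose_mult[OF T U] TU by simp
  have THT: "transpose_mat T * ?H * T = D"
  proof -
    have "transpose_mat T * ?H * T = transpose_mat W * (?K * W)"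
      unfolding T_def transpose_mult[OF S(1) W] precond_hessian_def using S(1) W Wt St H
      by (simp add: assoc_mult_mat[of _ n n _ n _ n])
    also have "\<dots> = (transpose_mat W * W) * D"
      unfolding KW using assoc_mult_mat[OF Wt W Dc] by simp
    finally show ?thesis unfolding WtW using Dc by simp
  qed
  have HU: "?H = transpose_mat U * D * U"
  proof -
    have "transpose_mat U * D * U = (transpose_mat U * transpose_mat T) * ?H * (T * U)"
      unfolding THT[symmetric] using T U Tt Ut H by (simp add: assoc_mult_mat[of _ n n _ n _ n])
    thus ?thesis unfolding UtTt TU using H by simp
  qed
  have inv_pr: "mat_inv \<Gamma>pr = transpose_mat U * U"
  proof (rule mat_inv_eqI)
    have "\<Gamma>pr * (transpose_mat U * U) = T * (transpose_mat T * transpose_mat U) * U"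
      unfolding TTt[symmetric] using T U Tt Ut by (simp add: assoc_mult_mat[of _ n n _ n _ n])
    thus "\<Gamma>pr * (transpose_mat U * U) = 1\<^sub>m n" unfolding TtUt using T U TU by simp
  qed (use pr U in \<open>auto simp: pos_def_mat_def\<close>)
  \<comment> \<open>The posterior precision in these coordinates; its diagonal entries are the
    reciprocals of those of \<open>e\<close>.\<close>
  define L where "L = D + 1\<^sub>m n"
  have L: "L \<in> carrier_mat n n" by (simp add: L_def)
  have precision: "?H + mat_inv \<Gamma>pr = transpose_mat U * L * U"
    unfolding HU inv_pr L_def using U Ut
    by (simp add: mult_add_distrib_mat[OF Ut Dc one_carrier_mat]
        add_mult_distrib_mat[OF mult_carrier_mat[OF Ut Dc] Ut U])
  have E: "mat_diag n e \<in> carrier_mat n n" by simp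
  have DE: "L * mat_diag n e = 1\<^sub>m n"
  proof -
    have "L = mat_diag n (\<lambda>i. 1 + (\<delta> (Suc i))\<^sup>2)"
      by (intro eq_matI) (auto simp: L_def D_def mat_diag_def)
    hence "L * mat_diag n e = mat_diag n (\<lambda>i. 1)"
      using one by (simp add: e_def less_imp_neq[symmetric])
    thus ?thesis by simp
  qed
  have \<Gamma>pos: "\<Gamma>pos = T * mat_diag n e * transpose_mat T"
    unfolding pos posterior_cov_def precision
  proof (rule mat_inv_eqI)
    let ?X = "mat_diag n e * transpose_mat T"
    have X: "?X \<in> carrier_mat n n" using E Tt by (rule mult_carrier_mat)
    have TX: "T * ?X \<in> carrier_mat n n" using T X by (rule mult_carrier_mat)
    have UL: "transpose_mat U * L \<in> carrier_mat n n" using Ut L by (rule mult_carrier_mat)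
    have "(transpose_mat U * L * U) * (T * mat_diag n e * transpose_mat T) =
        transpose_mat U * L * (U * (T * ?X))"
      unfolding assoc_mult_mat[OF T E Tt] by (rule assoc_mult_mat[OF UL U TX])
    also have "U * (T * ?X) = ?X"
      using assoc_mult_mat[OF U T X] left_mult_one_mat[OF X] by (simp add: UT)
    also have "transpose_mat U * L * ?X = transpose_mat U * (L * mat_diag n e * transpose_mat T)"
      unfolding assoc_mult_mat[OF L E Tt] by (rule assoc_mult_mat[OF Ut L X])
    finally show "(transpose_mat U * L * U) * (T * mat_diag n e * transpose_mat T) = 1\<^sub>m n"
      unfolding DE using Tt UtTt by simp
  qed (use T U in auto)

  have prc: "\<Gamma>pr \<in> carrier_mat n n" using pr by (simp add: pos_def_mat_def)
  have TFT: "(T * mat_diag n f * transpose_mat T) $$ (a, b) =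
      (\<Sum>i<r. (\<delta> (Suc i))\<^sup>2 / (1 + (\<delta> (Suc i))\<^sup>2) * T $$ (a, i) * T $$ (b, i))"
    if "a < n" "b < n" for a b
  proof -
    have "(T * mat_diag n f * transpose_mat T) $$ (a, b) = (\<Sum>i<n. f i * T $$ (a, i) * T $$ (b, i))"
      using congruence_mat_diag_index[OF Tt, of a b f] that T by simp
    also have "\<dots> = (\<Sum>i<r. f i * T $$ (a, i) * T $$ (b, i))"
      using r by (intro sum.mono_neutral_right) (auto simp: f_def)
    finally show ?thesis by (simp add: f_def)
  qed
  have Tw: "(S *\<^sub>v w (Suc i)) $ a = T $$ (a, i)" if "i < n" "a < n" for i a
    using that S(1) W by (simp add: T_def colW)
  have Fc: "T * mat_diag n f * transpose_mat T \<in> carrier_mat n n"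
    by (rule mult_carrier_mat[OF mult_carrier_mat[OF T mat_diag_dim] Tt])
  have star': "\<Gamma>star = \<Gamma>pr - T * mat_diag n f * transpose_mat T"
  proof -
    have "(\<Oplus>\<^bsub>module_mat TYPE(real) n n\<^esub> i \<in> {1..r}.
        ((\<delta> i)\<^sup>2 / (1 + (\<delta> i)\<^sup>2)) \<cdot>\<^sub>m outer_prod (S *\<^sub>v w i) (S *\<^sub>v w i)) =
        T * mat_diag n f * transpose_mat T" (is "?sum = _")
    proof (rule eq_matI)
      have *: "?sum = mat n n (\<lambda>(a, b). \<Sum>i\<in>{1..r}.
          (((\<delta> i)\<^sup>2 / (1 + (\<delta> i)\<^sup>2)) \<cdot>\<^sub>m outer_prod (S *\<^sub>v w i) (S *\<^sub>v w i)) $$ (a, b))"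
        using S(1) by (intro finsum_module_mat) (auto simp: outer_prod_def)
      show "dim_row ?sum = dim_row (T * mat_diag n f * transpose_mat T)"
        "dim_col ?sum = dim_col (T * mat_diag n f * transpose_mat T)"
        unfolding * using T by auto
      fix a b assume "a < dim_row (T * mat_diag n f * transpose_mat T)"
        "b < dim_col (T * mat_diag n f * transpose_mat T)"
      hence ab: "a < n" "b < n" using T by auto
      have "?sum $$ (a, b) = (\<Sum>i\<in>{1..r}. (\<delta> i)\<^sup>2 / (1 + (\<delta> i)\<^sup>2) * (S *\<^sub>v w i) $ a * (S *\<^sub>v w i) $ b)"
        unfolding * using ab S(1) by (auto simp: outer_prod_def intro!: sum.cong)
      also have "\<dots> = (\<Sum>i<r. (\<delta> (Suc i))\<^sup>2 / (1 + (\<delta> (Suc i))\<^sup>2) * T $$ (a, i) * T $$ (b, i))"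
        using r ab by (simp add: sum.atLeast1_atMost_eq Tw del: index_mult_mat_vec)
      finally show "?sum $$ (a, b) = (T * mat_diag n f * transpose_mat T) $$ (a, b)"
        using TFT[OF ab] by simp
    qed
    thus ?thesis unfolding star opt_cov_def by simp
  qed
  have \<Gamma>star: "\<Gamma>star = T * mat_diag n s * transpose_mat T"
  proof -
    have "mat_diag n s = 1\<^sub>m n - mat_diag n f" by (intro eq_matI) (auto simp: mat_diag_def sf)
    thus ?thesis
      using congruence_minus[OF T one_carrier_mat mat_diag_dim, of f] T
      by (simp add: star' TTt)
  qed

  have mem: "\<Gamma>star \<in> approx_class n r \<Gamma>pr \<Gamma>pos"
  proof -
    \<comment> \<open>The first \<open>r\<close> columns of \<open>T\<close> scaled by square roots,
      so that \<open>B B^T\<close> is the subtracted sum; having only \<open>r\<close> columns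
      bounds the rank.\<close>
    define B where "B = mat n r (\<lambda>(a, i). sqrt ((\<delta> (Suc i))\<^sup>2 / (1 + (\<delta> (Suc i))\<^sup>2)) * T $$ (a, i))"
    have B: "B \<in> carrier_mat n r" by (simp add: B_def)
    have sq: "sqrt ((\<delta> (Suc i))\<^sup>2 / (1 + (\<delta> (Suc i))\<^sup>2)) * x * (sqrt ((\<delta> (Suc i))\<^sup>2 / (1 + (\<delta> (Suc i))\<^sup>2)) * y)
      = (\<delta> (Suc i))\<^sup>2 / (1 + (\<delta> (Suc i))\<^sup>2) * x * y" for i x y
    proof -
      have "sqrt c * x * (sqrt c * y) = c * x * y" if "0 \<le> c" for c
        using real_sqrt_mult_self[of c] that by (metis abs_of_nonneg mult.assoc mult.left_commute)
      thus ?thesis using one by (simp only: divide_nonneg_pos zero_le_power2)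
    qed
    have "B * transpose_mat B = T * mat_diag n f * transpose_mat T"
    proof (rule eq_matI)
      fix a b assume "a < dim_row (T * mat_diag n f * transpose_mat T)"
        "b < dim_col (T * mat_diag n f * transpose_mat T)"
      hence ab: "a < n" "b < n" using T by auto
      show "(B * transpose_mat B) $$ (a, b) = (T * mat_diag n f * transpose_mat T) $$ (a, b)"
        unfolding TFT[OF ab] using ab
        by (simp add: B_def scalar_prod_def sq atLeast0LessThan del: real_sqrt_divide real_sqrt_abs)
    qed (use B T in auto)
    moreover have "vec_space.rank n B \<le> r" using B by (rule vec_space.rank_le_nc)
    moreover have "pos_semidef_mat n (\<Gamma>star - \<Gamma>pos)"
    proof -
      have "pos_semidef_mat n (transpose_mat (transpose_mat T) * mat_diag n (\<lambda>i. s i - e i) * transpose_mat T)"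
        using e by (intro pos_semidef_congruence[OF pos_semidef_mat_diag Tt]) (auto simp: s_def)
      also have "mat_diag n (\<lambda>i. s i - e i) = mat_diag n s - mat_diag n e"
        by (intro eq_matI) (auto simp: mat_diag_def)
      also have "transpose_mat (transpose_mat T) * (mat_diag n s - mat_diag n e) * transpose_mat T = \<Gamma>star - \<Gamma>pos"
        unfolding \<Gamma>star \<Gamma>pos using congruence_minus[OF T mat_diag_dim mat_diag_dim] by simp
      finally show ?thesis .
    qed
    ultimately show ?thesis unfolding approx_class_def star' using B by (auto intro!: exI[of _ r] bexI[of _ B])
  qed

  have det_pr: "det \<Gamma>pr = (det T)\<^sup>2"
    using det_mult[OF T Tt] det_transpose[OF T] by (simp add: TTt power2_eq_square)
  have det_pos: "det \<Gamma>pos = (det T)\<^sup>2 * (\<Prod>i<n. e i)"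
    unfolding \<Gamma>pos by (simp add: det_congruence[OF T] det_mat_diag)
  have "(\<Prod>i<n. s i) = (\<Prod>i<r. s i)"
    using r by (intro prod.mono_neutral_right) (auto simp: s_def)
  hence det_star: "det \<Gamma>star = (det T)\<^sup>2 * (\<Prod>i<r. e i)"
    unfolding \<Gamma>star by (simp add: det_congruence[OF T] det_mat_diag s_def)
  have least: "det \<Gamma>star \<le> det \<Gamma>" if "\<Gamma> \<in> approx_class n r \<Gamma>pr \<Gamma>pos" for \<Gamma>
    unfolding det_star
    using that e e_mono r(2) unfolding \<Gamma>pos TTt[symmetric] by (intro det_approx_class_ge[OF T U TU]) auto
  have prod_pos: "0 < (\<Prod>i\<in>I. e i)" for I using e by (intro prod_pos) auto
  have split: "(\<Prod>i<n. e i) = (\<Prod>i<r. e i) * (\<Prod>i=r..<n. e i)"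
    using r(2) by (simp add: prod.union_disjoint[symmetric] ivl_disj_un ivl_disj_int flip: atLeast0LessThan)
  have T2: "0 < (det T)\<^sup>2" using detT by simp
  have pos0: "0 < det \<Gamma>pos" and star0: "0 < det \<Gamma>star" and pr0: "0 < det \<Gamma>pr"
    unfolding det_pos det_star det_pr using T2 prod_pos by auto
  have "(\<Prod>i=r..<n. e i) \<le> 1" using e by (intro prod_le_1) (auto intro: less_imp_le)
  hence pos_le: "det \<Gamma>pos \<le> det \<Gamma>star"
    unfolding det_pos det_star split using T2 prod_pos[of "{..<r}"] by (simp add: mult_left_le)
  have ln_e: "ln (\<Prod>i\<in>I. e i) = - (\<Sum>i\<in>I. ln (1 + (\<delta> (Suc i))\<^sup>2))" if "finite I" for I
  proof -
    have "ln (\<Prod>i\<in>I. e i) = (\<Sum>i\<in>I. ln (e i))" using that e by (intro ln_prod) (auto simp: less_imp_neq[symmetric])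
    also have "\<dots> = (\<Sum>i\<in>I. - ln (1 + (\<delta> (Suc i))\<^sup>2))"
      using one by (intro sum.cong refl) (simp add: e_def ln_div)
    finally show ?thesis by (simp add: sum_negf)
  qed
  \<comment> \<open>The order
    \<open>det \<Gamma>pos \<le> det \<Gamma>star \<le> det \<Gamma>\<close> of positive numbers
    resolves the absolute values: a smaller error means a smaller determinant.\<close>
  have gap: "\<bar>ln (det \<Gamma>pos / det \<Gamma>star)\<bar> \<le> \<bar>ln (det \<Gamma>pos / det \<Gamma>)\<bar>"
    and diff: "\<bar>ln (det \<Gamma>pr / det \<Gamma>pos) - ln (det \<Gamma>pr / det \<Gamma>)\<bar> = \<bar>ln (det \<Gamma>pos / det \<Gamma>)\<bar>"
    if "\<Gamma> \<in> approx_class n r \<Gamma>pr \<Gamma>pos" for \<Gamma>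
  proof -
    have "0 < det \<Gamma>" using least[OF that] star0 by linarith
    thus "\<bar>ln (det \<Gamma>pos / det \<Gamma>star)\<bar> \<le> \<bar>ln (det \<Gamma>pos / det \<Gamma>)\<bar>"
      "\<bar>ln (det \<Gamma>pr / det \<Gamma>pos) - ln (det \<Gamma>pr / det \<Gamma>)\<bar> = \<bar>ln (det \<Gamma>pos / det \<Gamma>)\<bar>"
      using least[OF that] pos_le pos0 star0 pr0 ln_le_cancel_iff[of "det \<Gamma>pos" "det \<Gamma>star"]
        ln_le_cancel_iff[of "det \<Gamma>star" "det \<Gamma>"]
      by (auto simp: ln_div)
  qed
  have "ln (det \<Gamma>pr / det \<Gamma>star) = - ln (\<Prod>i<r. e i)"
    using T2 prod_pos[of "{..<r}"] by (simp add: det_pr det_star ln_div ln_mult e0)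
  also have "\<dots> = (\<Sum>i = 1..r. ln (1 + (\<delta> i)\<^sup>2))"
    by (simp add: ln_e sum.atLeast1_atMost_eq)
  finally have val: "ln (det \<Gamma>pr / det \<Gamma>star) = (\<Sum>i = 1..r. ln (1 + (\<delta> i)\<^sup>2))" .
  \<comment> \<open>The first \<open>r\<close> factors and the determinant of \<open>T\<close>
    cancel in the quotient.\<close>
  have "ln (det \<Gamma>star / det \<Gamma>pos) = - ln (\<Prod>i=r..<n. e i)"
    using T2 prod_pos[of "{..<r}"] prod_pos[of "{r..<n}"]
    by (simp add: det_pos det_star split ln_div ln_mult e0)
  also have "\<dots> = (\<Sum>i = r..<n. ln (1 + (\<delta> (Suc i))\<^sup>2))" by (simp add: ln_e)
  also have "\<dots> = (\<Sum>i = r + 1..n. ln (1 + (\<delta> i)\<^sup>2))"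
    using sum.shift_bounds_Suc_ivl[of "\<lambda>i. ln (1 + (\<delta> i)\<^sup>2)" r n]
    by (simp add: atLeastLessThanSuc_atLeastAtMost)
  finally have err: "ln (det \<Gamma>star / det \<Gamma>pos) = (\<Sum>i = r + 1..n. ln (1 + (\<delta> i)\<^sup>2))" .
  show ?thesis
    unfolding is_arg_min_def
  proof (intro conjI notI mem val err; elim exE conjE)
    fix \<Gamma> assume \<Gamma>: "\<Gamma> \<in> approx_class n r \<Gamma>pr \<Gamma>pos"
    \<comment> \<open>The simplified objective is settled first, since \<open>diff\<close> reduces
      the other one to it.\<close>
    show False if "\<bar>ln (det \<Gamma>pos / det \<Gamma>)\<bar> < \<bar>ln (det \<Gamma>pos / det \<Gamma>star)\<bar>"
      using that gap[OF \<Gamma>] by simp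
    thus False if "\<bar>ln (det \<Gamma>pr / det \<Gamma>pos) - ln (det \<Gamma>pr / det \<Gamma>)\<bar>
        < \<bar>ln (det \<Gamma>pr / det \<Gamma>pos) - ln (det \<Gamma>pr / det \<Gamma>star)\<bar>"
      using that unfolding diff[OF \<Gamma>] diff[OF mem] .
  qed
qed

end
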